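(* Let $p(x,y)\in\mathbb{R}[x,y]$. If $\deg_x p$ or $\deg_y p$ is odd, then $p(x,y)$ has uncountably many zeros in $\mathbb{R}^2$.
   Context: $\deg_x p$ (respectively $\deg_y p$) denotes the degree of $p$ in the variable $x$ (respectively $y$), i.e. the degree of $p$ viewed as a polynomial in $x$ with coefficients in $\mathbb{R}[y]$ (respectively in $y$ with coefficients in $\mathbb{R}[x]$). A zero of $p$ is a point $(a,b)\in\mathbb{R}^2$ with $p(a,b)=0$. *)

theory Defs
  imports
    Complex_Main
    "HOL-Library.Countable_Set"
    "HOL-Computational_Algebra.Polynomial"
begin

text \<open>
  Elements of R[x, y] are represented by the type \<^typ>\<open>real poly poly\<close>, read as R[x][y]: the outer
  variable is y and the coefficients are polynomials in x, so that
  \<open>coeff (coeff p j) i\<close> is the coefficient of the monomial \<open>x^i y^j\<close>.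
\<close>

definition eval2 :: "real poly poly \<Rightarrow> real \<Rightarrow> real \<Rightarrow> real" where
  "eval2 p a b = poly (poly p [:b:]) a"

text \<open>The same polynomial viewed as an element of R[y][x].\<close>

definition swap_vars :: "real poly poly \<Rightarrow> real poly poly" where
  "swap_vars p = (\<Sum>j\<le>degree p. \<Sum>i\<le>degree (coeff p j).
     monom (monom (coeff (coeff p j) i) j) i)"

definition deg_y :: "real poly poly \<Rightarrow> nat" where
  "deg_y p = degree p"

definition deg_x :: "real poly poly \<Rightarrow> nat" where
  "deg_x p = degree (swap_vars p)"

definition zeros2 :: "real poly poly \<Rightarrow> (real \<times> real) set" where
  "zeros2 p = {(a, b). eval2 p a b = 0}"

lemma coeff_swap_vars: "coeff (coeff (swap_vars p) i) j = coeff (coeff p j) i"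
proof -
  have inner: "(\<Sum>i'\<le>degree (coeff p j').
      coeff (coeff (monom (monom (coeff (coeff p j') i') j') i') i) j)
      = (if j' = j then coeff (coeff p j) i else 0)" for j'
  proof -
    have "(\<Sum>i'\<le>degree (coeff p j').
        coeff (coeff (monom (monom (coeff (coeff p j') i') j') i') i) j)
        = (\<Sum>i'\<le>degree (coeff p j'). if i' = i then (if j' = j then coeff (coeff p j) i else 0) else 0)"
      by (intro sum.cong) auto
    also have "\<dots> = (if j' = j then coeff (coeff p j) i else 0)"
      by (auto simp: sum.delta coeff_eq_0)
    finally show ?thesis .
  qed
  show ?thesis
    unfolding swap_vars_def coeff_sum inner
    by (auto simp: sum.delta coeff_eq_0)
qed

lemma eval2_altdef:
  "eval2 p a b = (\<Sum>j\<le>degree p. \<Sum>i\<le>degree (coeff p j). coeff (coeff p j) i * a ^ i * b ^ j)"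
  unfolding eval2_def poly_altdef[of p] poly_sum poly_mult poly_power
  by (simp add: poly_altdef sum_distrib_right)

lemma eval2_swap_vars: "eval2 (swap_vars p) b a = eval2 p a b"
  unfolding eval2_altdef[of p]
  by (simp add: eval2_def swap_vars_def poly_sum poly_monom poly_power algebra_simps)

end

theory Submission
  imports Defs "HOL-Analysis.Continuum_Not_Denumerable"
begin

text \<open>
  Specializing \<open>x = a\<close> at any of the cofinitely many \<open>a\<close> where the leading coefficient in \<open>y\<close> does
  not vanish leaves a univariate polynomial of odd degree, which has a real root.
\<close>

text \<open>Far out on the two sides an odd-degree polynomial has opposite signs, so the
  intermediate value theorem applies. Replacing \<open>q\<close> by \<open>- q\<close> reduces to a
  positive leading coefficient.\<close>

lemma odd_degree_imp_real_root:
  fixes q :: "real poly"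
  assumes "odd (degree q)"
  shows "\<exists>x. poly q x = 0"
proof -
  have pos: "\<exists>x. poly r x = 0" if odd: "odd (degree r)" and lc: "lead_coeff r > 0"
    for r :: "real poly"
  proof -
    \<comment> \<open>Here \<open>s\<close> is -r(-x). As the degree is odd, the two signs cancel in
      the leading coefficient, so the lower bound for \<open>s\<close> near plus infinity shows that
      \<open>r\<close> is negative near minus infinity.\<close>
    define s where "s = - pcompose r [:0, -1:]"
    have "lead_coeff (pcompose r [:0, -1:]) = - lead_coeff r"
      using odd by (subst lead_coeff_comp) auto
    hence "lead_coeff s > 0"
      using lc by (simp add: s_def)
    then obtain m where m: "\<And>x. x \<ge> m \<Longrightarrow> poly s x \<ge> lead_coeff s"
      using poly_pinfty_gt_lc by blast
    obtain n where n: "\<And>x. x \<ge> n \<Longrightarrow> poly r x \<ge> lead_coeff r"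
      using poly_pinfty_gt_lc[OF lc] by blast
    \<comment> \<open>The 1 ensures \<open>- b < b\<close>, as \<open>m\<close> and \<open>n\<close>
      may be negative.\<close>
    define b where "b = max 1 (max m n)"
    have "poly r b > 0"
      using n[of b] lc by (simp add: b_def max.coboundedI2)
    moreover have "poly r (- b) < 0"
      using m[of b] \<open>lead_coeff s > 0\<close> by (simp add: b_def s_def poly_pcompose max.coboundedI2)
    moreover have "- b < b"
      by (simp add: b_def)
    ultimately show ?thesis
      using poly_IVT_pos[of "- b" b r] by blast
  qed
  have "lead_coeff q \<noteq> 0"
    using assms by auto
  then consider "lead_coeff q > 0" | "lead_coeff (- q) > 0"
    by fastforce
  thus ?thesis
    using pos[of q] pos[of "- q"] assms by cases auto
qed

text \<open>Fixing x = a coefficientwise keeps a univariate polynomial in y, whose degree and roots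
  can then be discussed.\<close>

lemma poly_map_poly_eq_eval2: "poly (map_poly (\<lambda>c. poly c a) p) b = eval2 p a b"
proof (induction p)
  case (pCons c p)
  thus ?case
    by (simp add: eval2_def map_poly_pCons)
qed (simp add: eval2_def)

text \<open>The projection of the zero set to the x-axis, together with the finitely many roots of
  the leading coefficient, covers the real line; a countable zero set would make this cover
  countable.\<close>

lemma uncountable_zeros2_if_odd_deg_y:
  assumes "odd (deg_y p)"
  shows "uncountable (zeros2 p)"
proof
  assume "countable (zeros2 p)"
  moreover have "lead_coeff p \<noteq> 0"
    using assms by (auto simp: deg_y_def)
  ultimately have countable: "countable (fst ` zeros2 p \<union> {a. poly (lead_coeff p) a = 0})"
    by (simp add: countable_finite poly_roots_finite)
  have "a \<in> fst ` zeros2 p" if "poly (lead_coeff p) a \<noteq> 0" for a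
  proof -
    have "degree (map_poly (\<lambda>c. poly c a) p) = degree p"
      using that by (rule map_poly_degree_eq)
    then obtain b where "eval2 p a b = 0"
      using odd_degree_imp_real_root[of "map_poly (\<lambda>c. poly c a) p"] assms
      by (auto simp: deg_y_def poly_map_poly_eq_eval2)
    thus ?thesis
      by (force simp: zeros2_def)
  qed
  hence "(UNIV :: real set) = fst ` zeros2 p \<union> {a. poly (lead_coeff p) a = 0}"
    by blast
  thus False
    using countable uncountable_UNIV_real by simp
qed

text \<open>Reflecting in the diagonal preserves uncountability, so this carries the case of odd
  degree in y over to x.\<close>

lemma zeros2_swap_vars: "zeros2 (swap_vars p) = prod.swap ` zeros2 p"
  by (force simp: zeros2_def eval2_swap_vars)

theorem theorem2:
  fixes p :: "real poly poly"
  assumes "odd (deg_x p) \<or> odd (deg_y p)"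
  shows "uncountable (zeros2 p)"
  using assms
proof
  assume "odd (deg_x p)"
  hence "uncountable (zeros2 (swap_vars p))"
    by (intro uncountable_zeros2_if_odd_deg_y) (simp add: deg_x_def deg_y_def)
  thus ?thesis
    by (auto simp: zeros2_swap_vars)
qed (rule uncountable_zeros2_if_odd_deg_y)

end
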